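(* Let $K=\mathbb{C}(x_1,\dots,x_n)$, let $\preceq^\rho$ be a total order on the monomials in $\lambda,x_1,\dots,x_n$ compatible with multiplication, and let $p(\lambda),q(\lambda)\in K[\lambda]$ with $q$ $\rho$-factorable. Then $\mathop{\mathrm{CT}}^\rho_\lambda\, p(\lambda)/q(\lambda)$ lies in $K$, i.e. is (the expansion of) a rational function.
   Context: $\mathbb{C}^\rho\ll\lambda,\mathbf{x}\gg$ is the field of formal series over the monomials in $\lambda,\mathbf{x}$ with well-ordered support for $\preceq^\rho$; it contains $K(\lambda)$, so each rational function has a unique expansion there. $\mathop{\mathrm{CT}}^\rho_\lambda F$ is the coefficient of $\lambda^0$ (a series in $\mathbf{x}$) in the expansion of $F$. For nonzero $q=\sum_{i=0}^d a_i\lambda^i$ ($a_d\ne0$), the nonzero terms $a_i\lambda^i$ have distinct orders (least monomial of support); the one of least order, $a_j\lambda^j$, is the $\lambda$-initial term; $1/q$ is $\mathrm{PT}^\rho$ in $\lambda$ if $j=0$ and $\mathrm{NT}^\rho$ in $\lambda$ if $j=d$. $q$ is $\rho$-factorable if $q=q_1q_2$ with $q_1,q_2\in K[\lambda]$, $1/q_1$ $\mathrm{PT}^\rho$ in $\lambda$ and $1/q_2$ $\mathrm{NT}^\rho$ in $\lambda$. *)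

theory Defs
  imports
    Complex_Main
    "HOL-Library.Poly_Mapping"
    "HOL-Library.Product_Plus"
    "HOL-Computational_Algebra.Polynomial"
    "HOL-Computational_Algebra.Fraction_Field"
begin

text \<open>
  The pair \<open>(i, m)\<close> encodes the Laurent monomial \<open>\<lambda>^i * x^m\<close>, the variables \<open>x\<close> being indexed by
  \<open>'n\<close>. Multiplication of monomials is addition of exponents, so all orders and supports below
  live on an additively written free abelian group.
\<close>
type_synonym 'n monomial = "int \<times> ('n \<Rightarrow>\<^sub>0 int)"

text \<open>
  The linear order on \<open>'n\<close> plays no mathematical role: the library needs it to
  recognise the polynomial ring as an integral domain.
\<close>
type_synonym 'n ratfun = "(('n \<Rightarrow>\<^sub>0 nat) \<Rightarrow>\<^sub>0 complex) fract"

type_synonym 'n series = "'n monomial \<Rightarrow> complex"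

definition monomial_order :: "'n monomial rel \<Rightarrow> bool" where
  "monomial_order \<rho> \<longleftrightarrow>
     linear_order \<rho> \<and> (\<forall>a b c. (a, b) \<in> \<rho> \<longrightarrow> (a + c, b + c) \<in> \<rho>)"

definition supp :: "'n series \<Rightarrow> 'n monomial set" where
  "supp F = {a. F a \<noteq> 0}"

definition MN :: "'n monomial rel \<Rightarrow> 'n series set" where
  "MN \<rho> = {F. well_order_on (supp F) (Restr \<rho> (supp F))}"

text \<open>
  For two members of \<open>MN \<rho>\<close> the index set of the sum is finite, so this is the usual Cauchy
  product, under which \<open>MN \<rho>\<close> is a field (with pointwise addition).
\<close>
definition mn_mult :: "'n series \<Rightarrow> 'n series \<Rightarrow> 'n series" where
  "mn_mult F G c = (\<Sum>(a, b) | a \<in> supp F \<and> b \<in> supp G \<and> a + b = c. F a * G b)"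

definition mpoly_series :: "(('n \<Rightarrow>\<^sub>0 nat) \<Rightarrow>\<^sub>0 complex) \<Rightarrow> 'n series" where
  "mpoly_series P c =
     (\<Sum>e \<in> Poly_Mapping.keys P.
        if c = (0, Poly_Mapping.map int e) then Poly_Mapping.lookup P e else 0)"

text \<open>
  The expansion of a fraction is the quotient in the field \<open>MN \<rho>\<close> of the expansions of numerator
  and denominator; it does not depend on the chosen representation as a fraction. This is done
  first for \<open>K\<close>, then for polynomials and fractions in \<open>\<lambda>\<close> over \<open>K\<close>.
\<close>
definition K_series :: "'n::linorder monomial rel \<Rightarrow> 'n ratfun \<Rightarrow> 'n series" where
  "K_series \<rho> r =
     (THE S. S \<in> MN \<rho> \<and>
        (\<exists>a b. b \<noteq> 0 \<and> r = Fract a b \<and> mn_mult (mpoly_series b) S = mpoly_series a))"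

text \<open>Multiplication of a series by \<open>\<lambda>^j\<close> shifts the exponent of \<open>\<lambda>\<close> by \<open>j\<close>.\<close>
definition poly_series :: "'n::linorder monomial rel \<Rightarrow> 'n ratfun poly \<Rightarrow> 'n series" where
  "poly_series \<rho> p = (\<lambda>(i, m). \<Sum>j\<le>degree p. K_series \<rho> (coeff p j) (i - int j, m))"

definition expansion :: "'n::linorder monomial rel \<Rightarrow> 'n ratfun poly fract \<Rightarrow> 'n series" where
  "expansion \<rho> f =
     (THE S. S \<in> MN \<rho> \<and>
        (\<exists>p q. q \<noteq> 0 \<and> f = Fract p q \<and> mn_mult (poly_series \<rho> q) S = poly_series \<rho> p))"

text \<open>The constant term is again viewed inside \<open>MN \<rho>\<close>, as a series free of \<open>\<lambda>\<close>.\<close>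
definition CT :: "'n::linorder monomial rel \<Rightarrow> 'n ratfun poly fract \<Rightarrow> 'n series" where
  "CT \<rho> f = (\<lambda>(i, m). if i = 0 then expansion \<rho> f (0, m) else 0)"

definition least_monomial :: "'n monomial rel \<Rightarrow> 'n series \<Rightarrow> 'n monomial" where
  "least_monomial \<rho> F = (THE a. a \<in> supp F \<and> (\<forall>b \<in> supp F. (a, b) \<in> \<rho>))"

definition term_order :: "'n::linorder monomial rel \<Rightarrow> 'n ratfun poly \<Rightarrow> nat \<Rightarrow> 'n monomial" where
  "term_order \<rho> q i = least_monomial \<rho> (poly_series \<rho> (monom (coeff q i) i))"

definition initial_index :: "'n::linorder monomial rel \<Rightarrow> 'n ratfun poly \<Rightarrow> nat \<Rightarrow> bool" where
  "initial_index \<rho> q j \<longleftrightarrow>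
     coeff q j \<noteq> 0 \<and> (\<forall>i. coeff q i \<noteq> 0 \<longrightarrow> (term_order \<rho> q j, term_order \<rho> q i) \<in> \<rho>)"

text \<open>The next two predicates are about \<open>1 / q\<close>; both imply that \<open>q\<close> is nonzero.\<close>
definition recip_PT :: "'n::linorder monomial rel \<Rightarrow> 'n ratfun poly \<Rightarrow> bool" where
  "recip_PT \<rho> q \<longleftrightarrow> initial_index \<rho> q 0"

definition recip_NT :: "'n::linorder monomial rel \<Rightarrow> 'n ratfun poly \<Rightarrow> bool" where
  "recip_NT \<rho> q \<longleftrightarrow> initial_index \<rho> q (degree q)"

definition factorable :: "'n::linorder monomial rel \<Rightarrow> 'n ratfun poly \<Rightarrow> bool" where
  "factorable \<rho> q \<longleftrightarrow> (\<exists>q1 q2. q = q1 * q2 \<and> recip_PT \<rho> q1 \<and> recip_NT \<rho> q2)"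

end

theory Submission
  imports Defs "HOL-Library.Function_Algebras"
begin

text \<open>
  Let \<open>q = q1 * q2\<close> with \<open>1 / q1\<close> PT and \<open>1 / q2\<close> NT. Initial terms are multiplicative, so the
  initial term of a common divisor \<open>g\<close> of \<open>q1\<close> and \<open>q2\<close> has index both \<open>0\<close> and \<open>degree g\<close>; hence
  \<open>q1\<close> and \<open>q2\<close> are coprime and \<open>p / q = A / q1 + B / q2\<close> with \<open>degree B < degree q2\<close>. The
  expansion \<open>S\<close> of \<open>A / q1\<close> has no negative powers of \<open>\<lambda>\<close>: if \<open>N\<close> is the sum of its terms with
  negative powers, \<open>q1 * N\<close> has only nonnegative powers, but its initial term is the product of
  those of \<open>q1\<close> (of index 0) and \<open>N\<close>. So its constant term is \<open>A(0) / q1(0)\<close>. Dually, \<open>B / q2\<close> has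
  only negative powers of \<open>\<lambda>\<close> and constant term 0.

  Inverses in the field of series are needed only for series of finite support, since
  denominators can be cleared; there the coefficients are found by recursion on a well-ordered
  monoid generated by finitely many positive monomials, which avoids Neumann's lemma.
\<close>

section \<open>Well-ordered subsets of ordered abelian groups\<close>

context linordered_ab_group_add
begin

text \<open>Stated for the class, so that the facts below carry over by interpretation to the
  monomials under any compatible order \<open>\<rho>\<close>.\<close>

definition wo :: "'a set \<Rightarrow> bool" where
  "wo A \<longleftrightarrow> (\<forall>B\<subseteq>A. B \<noteq> {} \<longrightarrow> (\<exists>m\<in>B. \<forall>b\<in>B. m \<le> b))"

lemma wo_least:
  assumes "wo A" "B \<subseteq> A" "B \<noteq> {}"
  obtains m where "m \<in> B" "\<And>b. b \<in> B \<Longrightarrow> m \<le> b"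
  using assms unfolding wo_def by metis

lemma wo_subset: "wo A \<Longrightarrow> B \<subseteq> A \<Longrightarrow> wo B"
  unfolding wo_def by (meson subset_trans)

lemma finite_imp_wo: "finite A \<Longrightarrow> wo A"
  unfolding wo_def by (meson Min_in Min_le finite_subset)

lemma wo_Un:
  assumes "wo A" "wo B" shows "wo (A \<union> B)"
  unfolding wo_def
proof (intro allI impI)
  fix C assume C: "C \<subseteq> A \<union> B" "C \<noteq> {}"
  show "\<exists>m\<in>C. \<forall>b\<in>C. m \<le> b"
  proof (cases "C \<inter> A = {} \<or> C \<inter> B = {}")
    case True
    then have "C \<subseteq> B \<or> C \<subseteq> A" using C by blast
    with C assms show ?thesis unfolding wo_def by blast
  next
    case False
    then obtain m where m: "m \<in> C \<inter> A" "\<And>b. b \<in> C \<inter> A \<Longrightarrow> m \<le> b"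
      using wo_least[OF assms(1), of "C \<inter> A"] by blast
    from False obtain n where n: "n \<in> C \<inter> B" "\<And>b. b \<in> C \<inter> B \<Longrightarrow> n \<le> b"
      using wo_least[OF assms(2), of "C \<inter> B"] by blast
    have least: "\<forall>b\<in>C. k \<le> b" if "k \<le> m" "k \<le> n" for k
      using that m(2) n(2) C(1) order_trans by (metis IntI UnE subsetD)
    show ?thesis
    proof (cases "m \<le> n")
      case True
      then show ?thesis using least[of m] m(1) by auto
    next
      case False
      then show ?thesis using least[of n] n(1) linear[of m n] by auto
    qed
  qed
qed

text \<open>Otherwise there is a least \<open>z\<close> with infinitely many elements of
  \<open>X\<close> up to it. The elements strictly below \<open>z\<close> are still infinitely many
  and have a greatest one \<open>w\<close>; by minimality of \<open>z\<close> only finitely many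
  elements lie up to \<open>w\<close>, a contradiction.\<close>

lemma finite_of_least_greatest:
  assumes "wo X" and max: "\<And>B. B \<subseteq> X \<Longrightarrow> B \<noteq> {} \<Longrightarrow> \<exists>m\<in>B. \<forall>b\<in>B. b \<le> m"
  shows "finite X"
proof (rule ccontr)
  assume inf: "infinite X"
  define Z where "Z = {x\<in>X. infinite {y\<in>X. y \<le> x}}"
  obtain m where "m \<in> X" "\<forall>b\<in>X. b \<le> m"
    using max[of X] inf by auto
  then have "{y\<in>X. y \<le> m} = X" by auto
  with inf \<open>m \<in> X\<close> have "m \<in> Z" by (simp add: Z_def)
  then obtain z where z: "z \<in> Z" "\<And>b. b \<in> Z \<Longrightarrow> z \<le> b"
    using wo_least[OF assms(1), of Z] by (auto simp: Z_def)
  define W where "W = {y\<in>X. y < z}"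
  have "{y\<in>X. y \<le> z} = insert z W" using z(1) by (auto simp: W_def Z_def le_less)
  then have "infinite W" using z(1) by (auto simp: Z_def)
  then have "W \<noteq> {}" by auto
  then obtain w where w: "w \<in> W" "\<forall>b\<in>W. b \<le> w"
    using max[of W] by (auto simp: W_def)
  then have "w \<notin> Z" using z(2)[of w] by (auto simp: W_def)
  then have "finite {y\<in>X. y \<le> w}" using w(1) by (auto simp: Z_def W_def)
  moreover have "W \<subseteq> {y\<in>X. y \<le> w}" using w by (auto simp: W_def)
  ultimately show False using \<open>infinite W\<close> finite_subset by blast
qed

text \<open>The reflection \<open>a \<mapsto> c - a\<close> turns least elements in \<open>B\<close>
  into greatest elements in \<open>A\<close>, so this set is well-ordered in both directions. This
  makes the sums in the Cauchy product finite.\<close>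

lemma finite_decompositions:
  assumes "wo A" "wo B"
  shows "finite {a\<in>A. c - a \<in> B}"
proof (rule finite_of_least_greatest)
  show "wo {a\<in>A. c - a \<in> B}" by (rule wo_subset[OF assms(1)]) auto
  fix C assume C: "C \<subseteq> {a\<in>A. c - a \<in> B}" "C \<noteq> {}"
  obtain m where "m \<in> (\<lambda>a. c - a) ` C" "\<And>b. b \<in> (\<lambda>a. c - a) ` C \<Longrightarrow> m \<le> b"
    using wo_least[OF assms(2), of "(\<lambda>a. c - a) ` C"] C by auto
  then obtain a where "a \<in> C" "\<And>b. b \<in> C \<Longrightarrow> c - a \<le> c - b" by auto
  moreover have "b \<le> a" if "c - a \<le> c - b" for b
    using add_left_mono[OF that, of "a + b - c"] by (simp add: algebra_simps)
  ultimately show "\<exists>m\<in>C. \<forall>b\<in>C. b \<le> m" by blast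
qed

definition sumset :: "'a set \<Rightarrow> 'a set \<Rightarrow> 'a set" where
  "sumset A B = {a + b | a b. a \<in> A \<and> b \<in> B}"

text \<open>
  Among the decompositions \<open>a + b\<close> that are not beaten by one with an equal or larger first
  summand, the one with least \<open>a\<close> gives the least sum.
\<close>
lemma wo_sumset:
  assumes A: "wo A" and B: "wo B"
  shows "wo (sumset A B)"
  unfolding wo_def
proof (intro allI impI)
  fix C assume C: "C \<subseteq> sumset A B" "C \<noteq> {}"
  define S where "S = {a\<in>A. \<exists>b\<in>B. a + b \<in> C \<and>
    (\<forall>a'\<in>A. \<forall>b'\<in>B. a' + b' \<in> C \<longrightarrow> a \<le> a' \<longrightarrow> a + b \<le> a' + b')}"
  have leastB: "\<exists>a b. (a, b) \<in> D \<and> (\<forall>(a', b')\<in>D. b \<le> b')" if "D \<subseteq> A \<times> B" "D \<noteq> {}" for D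
  proof -
    have "snd ` D \<subseteq> B" "snd ` D \<noteq> {}" using that by auto
    from wo_least[OF B this] obtain m where "m \<in> snd ` D" "\<And>b. b \<in> snd ` D \<Longrightarrow> m \<le> b" by blast
    then show ?thesis by force
  qed
  have "S \<noteq> {}"
  proof -
    define D where "D = {(a, b). a \<in> A \<and> b \<in> B \<and> a + b \<in> C}"
    have "D \<noteq> {}" using C by (auto simp: D_def sumset_def)
    then obtain a b where "(a, b) \<in> D" "\<forall>(a', b')\<in>D. b \<le> b'"
      using leastB[of D] by (auto simp: D_def)
    \<comment> \<open>With \<open>b\<close> least among all second summands, a decomposition whose
      first summand is at least \<open>a\<close> has a sum of at least \<open>a + b\<close>.\<close>
    then have "a \<in> S" by (auto simp: S_def D_def intro!: add_mono)
    then show ?thesis by auto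
  qed
  then obtain a where a: "a \<in> S" "\<And>a'. a' \<in> S \<Longrightarrow> a \<le> a'"
    using wo_least[OF A, of S] by (auto simp: S_def)
  then obtain b where b: "a \<in> A" "b \<in> B" "a + b \<in> C"
      "\<And>a' b'. a' \<in> A \<Longrightarrow> b' \<in> B \<Longrightarrow> a' + b' \<in> C \<Longrightarrow> a \<le> a' \<Longrightarrow> a + b \<le> a' + b'"
    by (auto simp: S_def)
  \<comment> \<open>The decompositions with a smaller sum. If there were any, the one with least
    second summand \<open>b0\<close> would put its \<open>a0\<close> into \<open>S\<close>;
    minimality of \<open>a\<close> then gives \<open>a \<le> a0\<close>, and the choice of
    \<open>b\<close> forces \<open>a + b \<le> a0 + b0\<close>.\<close>
  define D where "D = {(a', b'). a' \<in> A \<and> b' \<in> B \<and> a' + b' \<in> C \<and> a' + b' < a + b}"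
  have "D = {}"
  proof (rule ccontr)
    assume "D \<noteq> {}"
    then obtain a0 b0 where ab: "(a0, b0) \<in> D" "\<forall>(a', b')\<in>D. b0 \<le> b'"
      using leastB[of D] by (auto simp: D_def)
    then have "a0 \<in> A" "b0 \<in> B" "a0 + b0 \<in> C" and lt: "a0 + b0 < a + b" by (auto simp: D_def)
    moreover have "a0 + b0 \<le> a' + b'" if "a' \<in> A" "b' \<in> B" "a' + b' \<in> C" "a0 \<le> a'" for a' b'
    proof (cases "a' + b' < a + b")
      case True
      then show ?thesis using ab(2) that by (auto simp: D_def intro!: add_mono)
    next
      case False
      then show ?thesis using lt by (meson not_less less_imp_le order_trans)
    qed
    ultimately have "a0 \<in> S" by (auto simp: S_def)
    then have "a \<le> a0" by (rule a)
    then have "a + b \<le> a0 + b0" using b(4) \<open>a0 \<in> A\<close> \<open>b0 \<in> B\<close> \<open>a0 + b0 \<in> C\<close> by blast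
    then show False using lt by (simp add: not_less[symmetric])
  qed
  then have "\<forall>c\<in>C. a + b \<le> c"
    using C(1) by (force simp: D_def sumset_def not_less)
  with b(3) show "\<exists>m\<in>C. \<forall>c\<in>C. m \<le> c" by blast
qed

text \<open>The iterate is the \<open>n\<close>-fold sum of \<open>a\<close>. It is monotone in
  \<open>n\<close>, so the least index occurring in a subset yields its least element.\<close>

lemma wo_multiples:
  assumes "0 \<le> a"
  shows "wo (range (\<lambda>n. ((+) a ^^ n) 0))"
  unfolding wo_def
proof (intro allI impI)
  let ?f = "\<lambda>n. ((+) a ^^ n) 0"
  fix B assume B: "B \<subseteq> range ?f" "B \<noteq> {}"
  have mono: "?f n \<le> ?f (n + k)" for n k
  proof (induction k)
    case (Suc k)
    then show ?case using add_mono[OF assms] by simp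
  qed simp
  obtain n0 where "?f n0 \<in> B" using B by blast
  then have "?f (LEAST n. ?f n \<in> B) \<in> B" by (rule LeastI)
  moreover have "?f (LEAST n. ?f n \<in> B) \<le> ?f n" if "?f n \<in> B" for n
    using mono[of "LEAST n. ?f n \<in> B" "n - (LEAST n. ?f n \<in> B)"] Least_le[of "\<lambda>n. ?f n \<in> B", OF that]
    by simp
  ultimately show "\<exists>m\<in>B. \<forall>b\<in>B. m \<le> b" using B(1) by blast
qed

text \<open>The monoid generated by \<open>A\<close>, built one generator at a time: adjoining
  \<open>a\<close> means adding all multiples of \<open>a\<close>, and \<open>wo_sumset\<close>
  keeps the result well-ordered.\<close>

lemma ex_wo_closed:
  assumes "finite A" "\<And>a. a \<in> A \<Longrightarrow> 0 \<le> a"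
  shows "\<exists>M. wo M \<and> 0 \<in> M \<and> (\<forall>a\<in>A. \<forall>m\<in>M. a + m \<in> M)"
  using assms
proof (induction A)
  case empty
  then show ?case by (intro exI[of _ "{0}"]) (simp add: finite_imp_wo)
next
  case (insert a A)
  then obtain M where M: "wo M" "0 \<in> M" "\<forall>a\<in>A. \<forall>m\<in>M. a + m \<in> M" by auto
  let ?f = "\<lambda>n. ((+) a ^^ n) 0"
  let ?M = "sumset M (range ?f)"
  have "wo ?M" using M(1) wo_multiples[of a] insert.prems by (simp add: wo_sumset)
  moreover have "0 \<in> range ?f" using rangeI[of ?f 0] by (simp only: funpow_0)
  then have "0 \<in> ?M" using M(2) unfolding sumset_def by force
  moreover have "b + x \<in> ?M" if "b \<in> insert a A" "x \<in> ?M" for b x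
  proof -
    from that(2) obtain m n where x: "x = m + ?f n" "m \<in> M" by (auto simp: sumset_def)
    show ?thesis
    proof (cases "b = a")
      case True
      then have "b + x = m + ?f (Suc n)" using x by (simp add: algebra_simps)
      with x(2) show ?thesis unfolding sumset_def by blast
    next
      case False
      then have "b + m \<in> M" using M(3) that(1) x(2) by blast
      moreover have "b + x = (b + m) + ?f n" using x by (simp add: algebra_simps)
      ultimately show ?thesis unfolding sumset_def by blast
    qed
  qed
  ultimately show ?case by blast
qed

text \<open>Provides the well-founded relation for the recursion that defines the coefficients of an
  inverse.\<close>

lemma wf_wo: "wo M \<Longrightarrow> wf {(x, y). x \<in> M \<and> y \<in> M \<and> x < y}"
proof (rule wfI_min)
  fix x :: 'a and Q assume M: "wo M" and "x \<in> Q"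
  show "\<exists>z\<in>Q. \<forall>y. (y, z) \<in> {(x, y). x \<in> M \<and> y \<in> M \<and> x < y} \<longrightarrow> y \<notin> Q"
  proof (cases "Q \<inter> M = {}")
    case True
    then show ?thesis using \<open>x \<in> Q\<close> by blast
  next
    case False
    from wo_least[OF M _ this] obtain m where
      "m \<in> Q \<inter> M" "\<And>b. b \<in> Q \<inter> M \<Longrightarrow> m \<le> b" by blast
    then show ?thesis by (intro bexI[of _ m]) (auto simp: not_less[symmetric])
  qed
qed

end

section \<open>The ring of series with well-ordered support\<close>

locale ordered_monomials =
  fixes \<rho> :: "'n::linorder monomial rel"
  assumes order: "monomial_order \<rho>"
begin

definition le :: "'n monomial \<Rightarrow> 'n monomial \<Rightarrow> bool" (infix "\<sqsubseteq>" 50)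
  where "a \<sqsubseteq> b \<longleftrightarrow> (a, b) \<in> \<rho>"

definition less :: "'n monomial \<Rightarrow> 'n monomial \<Rightarrow> bool" (infix "\<sqsubset>" 50)
  where "a \<sqsubset> b \<longleftrightarrow> a \<sqsubseteq> b \<and> \<not> b \<sqsubseteq> a"

sublocale O: linordered_ab_group_add "(+)" "0 :: 'n monomial" "(-)" uminus le less
proof
  have lo: "linear_order \<rho>" and add: "\<And>a b c. (a, b) \<in> \<rho> \<Longrightarrow> (a + c, b + c) \<in> \<rho>"
    using order by (auto simp: monomial_order_def)
  note props = lo[unfolded linear_order_on_def partial_order_on_def preorder_on_def]
  show "a \<sqsubset> b \<longleftrightarrow> a \<sqsubseteq> b \<and> \<not> b \<sqsubseteq> a" for a b by (fact less_def)
  show refl: "a \<sqsubseteq> a" for a using props unfolding le_def by (metis UNIV_I refl_onD)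
  show "a \<sqsubseteq> c" if "a \<sqsubseteq> b" "b \<sqsubseteq> c" for a b c
    using props that unfolding le_def by (meson transD)
  show "a = b" if "a \<sqsubseteq> b" "b \<sqsubseteq> a" for a b
    using props that unfolding le_def by (meson antisymD)
  show "a \<sqsubseteq> b \<or> b \<sqsubseteq> a" for a b
    using props refl unfolding le_def total_on_def by (cases "a = b") blast+
  show "c + a \<sqsubseteq> c + b" if "a \<sqsubseteq> b" for a b c
    using add[of a b c] that by (simp add: le_def add.commute)
qed

text \<open>In a linear order minimal elements are least, so well-foundedness of the strict part
  amounts to the existence of least elements.\<close>

lemma MN_iff: "F \<in> MN \<rho> \<longleftrightarrow> O.wo (supp F)"
proof
  have lo: "linear_order \<rho>" using order by (simp add: monomial_order_def)
  show "O.wo (supp F)" if "F \<in> MN \<rho>"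
    unfolding O.wo_def
  proof (intro allI impI)
    fix B assume B: "B \<subseteq> supp F" "B \<noteq> {}"
    have "wf (Restr \<rho> (supp F) - Id)"
      using that by (simp add: MN_def well_order_on_def)
    from wfE_min'[OF this B(2)] obtain m where m: "m \<in> B"
      "\<And>y. (y, m) \<in> Restr \<rho> (supp F) - Id \<Longrightarrow> y \<notin> B" by blast
    have "m \<sqsubseteq> b" if "b \<in> B" for b
    proof (rule ccontr)
      assume "\<not> m \<sqsubseteq> b"
      then have "b \<sqsubseteq> m" "b \<noteq> m" using O.linear by auto
      then show False using m(1) m(2)[of b] that B by (auto simp: le_def subset_iff simp del: split_paired_All)
    qed
    then show "\<exists>m\<in>B. \<forall>b\<in>B. m \<sqsubseteq> b" using m by blast
  qed
  show "F \<in> MN \<rho>" if w: "O.wo (supp F)"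
  proof -
    have "linear_order_on (supp F) (Restr \<rho> (supp F))"
      unfolding linear_order_on_def partial_order_on_def preorder_on_def
    proof (intro conjI)
      show "Restr \<rho> (supp F) \<subseteq> supp F \<times> supp F" by blast
      show "refl_on (supp F) (Restr \<rho> (supp F))"
        using O.order_refl unfolding le_def refl_on_def by blast
      show "trans (Restr \<rho> (supp F))"
        using lo by (intro trans_Restr) (simp add: order_on_defs)
      show "antisym (Restr \<rho> (supp F))"
        using lo by (intro antisym_Restr) (simp add: order_on_defs)
      show "total_on (supp F) (Restr \<rho> (supp F))"
        by (rule total_onI) (use O.linear in \<open>unfold le_def, blast\<close>)
    qed
    moreover have "wf (Restr \<rho> (supp F) - Id)"
    proof (rule wfI_min)
      fix x :: "'n monomial" and Q assume "x \<in> Q"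
      show "\<exists>z\<in>Q. \<forall>y. (y, z) \<in> Restr \<rho> (supp F) - Id \<longrightarrow> y \<notin> Q"
      proof (cases "Q \<inter> supp F = {}")
        case True
        then show ?thesis using \<open>x \<in> Q\<close> by blast
      next
        case False
        from O.wo_least[OF w _ this] obtain m where
          "m \<in> Q \<inter> supp F" "\<And>b. b \<in> Q \<inter> supp F \<Longrightarrow> m \<sqsubseteq> b" by blast
        then show ?thesis by (metis (no_types, lifting) Diff_iff IdI IntI IntE O.order_antisym SigmaD1 le_def)
      qed
    qed
    ultimately show ?thesis by (simp add: MN_def well_order_on_def)
  qed
qed

section \<open>The ring operations\<close>

notation mn_mult (infixl "\<star>" 70)

text \<open>\<open>mono 0\<close> is the unit of the ring, and \<open>mono (1, 0)\<close> is the
  variable \<lambda>.\<close>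

definition mono :: "'n monomial \<Rightarrow> 'n series" where
  "mono a = (\<lambda>c. if c = a then 1 else 0)"

lemma not_supp [simp]: "a \<notin> supp F \<longleftrightarrow> F a = 0"
  by (simp add: supp_def)

lemma supp_add: "supp (F + G) \<subseteq> supp F \<union> supp G"
  by (auto simp: supp_def)

lemma supp_0 [simp]: "supp 0 = {}"
  by (auto simp: supp_def)

lemma supp_mono [simp]: "supp (mono a) = {a}"
  by (auto simp: supp_def mono_def)

lemma finite_supp_MN: "finite (supp F) \<Longrightarrow> F \<in> MN \<rho>"
  by (simp add: MN_iff O.finite_imp_wo)

lemma mono_MN [simp]: "mono a \<in> MN \<rho>"
  by (simp add: finite_supp_MN)

lemma zero_MN [simp]: "0 \<in> MN \<rho>"
  by (simp add: finite_supp_MN)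

lemma add_MN [simp]: "F \<in> MN \<rho> \<Longrightarrow> G \<in> MN \<rho> \<Longrightarrow> F + G \<in> MN \<rho>"
  using O.wo_subset[OF O.wo_Un supp_add] by (simp add: MN_iff)

lemma MN_subset: "F \<in> MN \<rho> \<Longrightarrow> supp G \<subseteq> supp F \<Longrightarrow> G \<in> MN \<rho>"
  using O.wo_subset by (auto simp: MN_iff)

lemma finite_supp_pairs:
  "F \<in> MN \<rho> \<Longrightarrow> G \<in> MN \<rho> \<Longrightarrow> finite {a \<in> supp F. c - a \<in> supp G}"
  by (simp add: O.finite_decompositions MN_iff)

text \<open>The second exponent is determined by the first. Allowing any finite superset
  \<open>X\<close> as index set lets several products be summed over a common set.\<close>

lemma mn_mult_eq:
  assumes "finite X" "{a \<in> supp F. c - a \<in> supp G} \<subseteq> X"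
  shows "(F \<star> G) c = (\<Sum>a\<in>X. F a * G (c - a))"
proof -
  let ?Y = "{a \<in> supp F. c - a \<in> supp G}"
  have "(F \<star> G) c = (\<Sum>a\<in>?Y. F a * G (c - a))"
    unfolding mn_mult_def
    by (rule sum.reindex_bij_witness[where i = "\<lambda>a. (a, c - a)" and j = fst])
      (auto simp del: split_paired_All split_paired_Ex)
  also have "\<dots> = (\<Sum>a\<in>X. F a * G (c - a))"
    using assms by (intro sum.mono_neutral_left) (auto simp: supp_def)
  finally show ?thesis .
qed

lemma mn_mult_commute: "F \<star> G = G \<star> F"
proof
  fix c
  show "(F \<star> G) c = (G \<star> F) c"
    unfolding mn_mult_def
    by (rule sum.reindex_bij_witness[where i = prod.swap and j = prod.swap])
      (auto simp: add.commute mult.commute)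
qed

lemma supp_mult:
  fixes F G :: "'n series"
  shows "supp (F \<star> G) \<subseteq> O.sumset (supp F) (supp G)"
proof
  fix c assume "c \<in> supp (F \<star> G)"
  then have "(F \<star> G) c \<noteq> 0" by (simp add: supp_def)
  then have "{(a, b). a \<in> supp F \<and> b \<in> supp G \<and> a + b = c} \<noteq> {}"
    unfolding mn_mult_def by force
  then show "c \<in> O.sumset (supp F) (supp G)" unfolding O.sumset_def by blast
qed

lemma mult_MN [simp]: "F \<in> MN \<rho> \<Longrightarrow> G \<in> MN \<rho> \<Longrightarrow> F \<star> G \<in> MN \<rho>"
  using O.wo_subset[OF O.wo_sumset supp_mult] by (simp add: MN_iff)

lemma finite_supp_mult:
  fixes F G :: "'n series"
  assumes "finite (supp F)" "finite (supp G)"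
  shows "finite (supp (F \<star> G))"
proof -
  have "O.sumset (supp F) (supp G) = (\<lambda>(a, b). a + b) ` (supp F \<times> supp G)"
    unfolding O.sumset_def by (force simp: image_iff)
  then show ?thesis using assms finite_subset[OF supp_mult[of F G]] by simp
qed

lemma mult_0 [simp]: "F \<star> 0 = 0" "0 \<star> F = 0"
  by (auto simp: mn_mult_def)

lemma mult_add:
  assumes "F \<in> MN \<rho>" "G \<in> MN \<rho>" "H \<in> MN \<rho>"
  shows "F \<star> (G + H) = F \<star> G + F \<star> H"
proof
  fix c
  let ?X = "{a \<in> supp F. c - a \<in> supp G} \<union> {a \<in> supp F. c - a \<in> supp H}"
  have fin: "finite ?X" using assms by (simp add: finite_supp_pairs)
  have "(F \<star> (G + H)) c = (\<Sum>a\<in>?X. F a * (G + H) (c - a))"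
    by (rule mn_mult_eq[OF fin]) (use supp_add in blast)
  moreover have "(F \<star> G) c = (\<Sum>a\<in>?X. F a * G (c - a))"
    by (rule mn_mult_eq[OF fin]) blast
  moreover have "(F \<star> H) c = (\<Sum>a\<in>?X. F a * H (c - a))"
    by (rule mn_mult_eq[OF fin]) blast
  ultimately show "(F \<star> (G + H)) c = (F \<star> G + F \<star> H) c"
    by (simp add: algebra_simps sum.distrib)
qed

lemma add_mult:
  "F \<in> MN \<rho> \<Longrightarrow> G \<in> MN \<rho> \<Longrightarrow> H \<in> MN \<rho> \<Longrightarrow> (G + H) \<star> F = G \<star> F + H \<star> F"
  using mult_add[of F G H] by (simp add: mn_mult_commute)

text \<open>Both sides become the same finite double sum, over the exponent \<open>a\<close> taken
  from \<open>F\<close> and the partial sum \<open>e\<close> of the exponents taken from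
  \<open>F\<close> and \<open>G\<close>.\<close>

lemma mn_mult_assoc:
  assumes "F \<in> MN \<rho>" "G \<in> MN \<rho>" "H \<in> MN \<rho>"
  shows "(F \<star> G) \<star> H = F \<star> (G \<star> H)"
proof
  fix c
  define E where "E = {e \<in> O.sumset (supp F) (supp G). c - e \<in> supp H}"
  define X where "X = {a \<in> supp F. c - a \<in> O.sumset (supp G) (supp H)}"
  have fin: "finite E" "finite X"
    using assms unfolding E_def X_def
    by (auto intro!: O.finite_decompositions O.wo_sumset simp: MN_iff)
  have "((F \<star> G) \<star> H) c = (\<Sum>e\<in>E. (F \<star> G) e * H (c - e))"
    by (rule mn_mult_eq[OF fin(1)]) (use supp_mult[of F G] in \<open>unfold E_def, blast\<close>)
  also have "\<dots> = (\<Sum>e\<in>E. \<Sum>a\<in>X. F a * G (e - a) * H (c - e))"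
  proof (rule sum.cong[OF refl])
    fix e assume e: "e \<in> E"
    have "c - a \<in> O.sumset (supp G) (supp H)" if "e - a \<in> supp G" for a
      using that e unfolding E_def O.sumset_def
      by (intro CollectI exI[of _ "e - a"] exI[of _ "c - e"]) (simp add: algebra_simps)
    then have "{a \<in> supp F. e - a \<in> supp G} \<subseteq> X" unfolding X_def by blast
    then show "(F \<star> G) e * H (c - e) = (\<Sum>a\<in>X. F a * G (e - a) * H (c - e))"
      by (simp add: mn_mult_eq[OF fin(2)] sum_distrib_right)
  qed
  also have "\<dots> = (\<Sum>a\<in>X. \<Sum>e\<in>E. F a * G (e - a) * H (c - e))"
    by (rule sum.swap)
  also have "\<dots> = (\<Sum>a\<in>X. F a * (G \<star> H) (c - a))"
  proof (rule sum.cong[OF refl])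
    fix a assume a: "a \<in> X"
    \<comment> \<open>The substitution \<open>b = e - a\<close> lets the inner product run over the
      same set \<open>E\<close> for every \<open>a\<close>.\<close>
    have "b \<in> (\<lambda>e. e - a) ` E" if "b \<in> supp G" "c - a - b \<in> supp H" for b
    proof
      show "b = (a + b) - a" by simp
      have "a + b \<in> O.sumset (supp F) (supp G)"
        using that a unfolding X_def O.sumset_def by blast
      then show "a + b \<in> E" using that(2) unfolding E_def by (simp add: algebra_simps)
    qed
    then have "(G \<star> H) (c - a) = (\<Sum>b\<in>(\<lambda>e. e - a) ` E. G b * H (c - a - b))"
      using fin by (intro mn_mult_eq) blast+
    also have "\<dots> = (\<Sum>e\<in>E. G (e - a) * H (c - e))"
      by (subst sum.reindex) (auto simp: inj_on_def)
    finally show "(\<Sum>e\<in>E. F a * G (e - a) * H (c - e)) = F a * (G \<star> H) (c - a)"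
      by (simp add: sum_distrib_left mult.assoc)
  qed
  also have "\<dots> = (F \<star> (G \<star> H)) c"
    by (rule mn_mult_eq[OF fin(2), symmetric]) (use supp_mult[of G H] in \<open>unfold X_def, blast\<close>)
  finally show "((F \<star> G) \<star> H) c = (F \<star> (G \<star> H)) c" .
qed

lemma mn_mult_left_commute:
  "F \<in> MN \<rho> \<Longrightarrow> G \<in> MN \<rho> \<Longrightarrow> H \<in> MN \<rho> \<Longrightarrow> F \<star> (G \<star> H) = G \<star> (F \<star> H)"
  by (metis mn_mult_assoc mn_mult_commute)

lemmas mn_ac = mn_mult_assoc mn_mult_commute mn_mult_left_commute

lemma mono_mult: "(mono a \<star> F) c = F (c - a)"
  by (subst mn_mult_eq[of "{a}"]) (auto simp: mono_def[of a, THEN fun_cong])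

lemma one_mult [simp]: "mono 0 \<star> F = F" "F \<star> mono 0 = F"
  by (auto simp: mono_mult mn_mult_commute[of F])

section \<open>Least monomials, cancellation and inverses\<close>

definition lm :: "'n series \<Rightarrow> 'n monomial" where
  "lm F = least_monomial \<rho> F"

lemma lm_eqI:
  assumes "a \<in> supp F" "\<And>b. b \<in> supp F \<Longrightarrow> a \<sqsubseteq> b"
  shows "lm F = a"
  unfolding lm_def least_monomial_def
  using assms O.order_antisym by (intro the_equality) (unfold le_def, blast+)

lemma
  assumes "F \<in> MN \<rho>" "F \<noteq> 0"
  shows lm_in: "lm F \<in> supp F" and lm_le: "\<And>b. b \<in> supp F \<Longrightarrow> lm F \<sqsubseteq> b"
proof -
  have "supp F \<noteq> {}" using assms(2) by (force simp: supp_def)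
  then obtain m where "m \<in> supp F" "\<And>b. b \<in> supp F \<Longrightarrow> m \<sqsubseteq> b"
    using O.wo_least[of "supp F" "supp F"] assms(1) by (metis MN_iff order_refl)
  moreover from this have "lm F = m" by (rule lm_eqI)
  ultimately show "lm F \<in> supp F" "\<And>b. b \<in> supp F \<Longrightarrow> lm F \<sqsubseteq> b" by blast+
qed

text \<open>The monomial \<open>lm F + lm G\<close> has only one decomposition into support
  elements, so its coefficient is a product of two nonzero numbers.\<close>

lemma
  assumes "F \<in> MN \<rho>" "F \<noteq> 0" "G \<in> MN \<rho>" "G \<noteq> 0"
  shows mult_nonzero: "F \<star> G \<noteq> 0" and lm_mult: "lm (F \<star> G) = lm F + lm G"
proof -
  note F = lm_in[OF assms(1,2)] lm_le[OF assms(1,2)]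
  note G = lm_in[OF assms(3,4)] lm_le[OF assms(3,4)]
  have "{a \<in> supp F. lm F + lm G - a \<in> supp G} \<subseteq> {lm F}"
  proof
    fix a assume a: "a \<in> {a \<in> supp F. lm F + lm G - a \<in> supp G}"
    then have "lm F \<sqsubseteq> a" "lm G \<sqsubseteq> lm F + lm G - a" using F(2) G(2) by blast+
    from O.add_right_mono[OF this(2), of "a - lm G"] have "a \<sqsubseteq> lm F" by (simp add: algebra_simps)
    with \<open>lm F \<sqsubseteq> a\<close> show "a \<in> {lm F}" using O.order_antisym by blast
  qed
  then have "(F \<star> G) (lm F + lm G) = F (lm F) * G (lm G)"
    by (subst mn_mult_eq[of "{lm F}"]) auto
  then have *: "(F \<star> G) (lm F + lm G) \<noteq> 0"
    using F(1) G(1) by (simp add: supp_def)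
  then show "F \<star> G \<noteq> 0" by auto
  show "lm (F \<star> G) = lm F + lm G"
  proof (rule lm_eqI)
    show "lm F + lm G \<in> supp (F \<star> G)" using * by (simp add: supp_def)
    fix c assume "c \<in> supp (F \<star> G)"
    then have "c \<in> O.sumset (supp F) (supp G)" using supp_mult by blast
    then show "lm F + lm G \<sqsubseteq> c"
      unfolding O.sumset_def using F(2) G(2) O.add_mono by blast
  qed
qed

lemma diff_MN [simp]: "F \<in> MN \<rho> \<Longrightarrow> G \<in> MN \<rho> \<Longrightarrow> F - G \<in> MN \<rho>"
  unfolding MN_iff by (erule (1) O.wo_subset[OF O.wo_Un]) (force simp: supp_def)

lemma mult_left_cancel:
  assumes "F \<in> MN \<rho>" "F \<noteq> 0" "G \<in> MN \<rho>" "H \<in> MN \<rho>" "F \<star> G = F \<star> H"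
  shows "G = H"
proof (rule ccontr)
  assume "G \<noteq> H"
  then have "F \<star> (G - H) \<noteq> 0"
    using assms by (intro mult_nonzero) auto
  moreover have "F \<star> (G - H) + F \<star> H = F \<star> H"
    using assms mult_add[of F "G - H" H] by simp
  ultimately show False by simp
qed

text \<open>Dividing \<open>F\<close> by its least monomial \<open>m\<close> moves the remaining
  exponents to finitely many positive \<open>a - m\<close>. The equation for the coefficient of the
  inverse at \<open>c\<close> then involves only coefficients at smaller monomials.\<close>

lemma ex_inverse_finite:
  assumes fin: "finite (supp F)" and "F \<noteq> 0"
  obtains G where "G \<in> MN \<rho>" "F \<star> G = mono 0"
proof -
  define m where "m = lm F"
  have m: "m \<in> supp F" "\<And>b. b \<in> supp F \<Longrightarrow> m \<sqsubseteq> b"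
    unfolding m_def using assms lm_in lm_le finite_supp_MN by blast+
  define A where "A = (\<lambda>a. a - m) ` (supp F - {m})"
  have pos: "0 \<sqsubset> a" if "a \<in> A" for a
    using that m(2) unfolding A_def by (auto simp: O.less_le simp del: split_paired_All)
  have "finite A" unfolding A_def using fin by blast
  then obtain M where M: "O.wo M" "0 \<in> M" "\<And>a x. a \<in> A \<Longrightarrow> x \<in> M \<Longrightarrow> a + x \<in> M"
    using O.ex_wo_closed[of A] pos O.less_imp_le by metis
  define R where "R = {(x, y). x \<in> M \<and> y \<in> M \<and> x \<sqsubset> y}"
  have "wf R" unfolding R_def by (rule O.wf_wo[OF M(1)])
  \<comment> \<open>The value is 0 outside \<open>M\<close>, which confines the support of the
    solution to \<open>M\<close>; the inner test ensures that only values at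
    \<open>R\<close>-smaller arguments are consulted.\<close>
  define step :: "'n series \<Rightarrow> 'n series" where
    "step h c = (if c \<in> M then ((if c = 0 then 1 else 0)
       - (\<Sum>a\<in>supp F - {m}. F a * (if c - (a - m) \<in> M then h (c - (a - m)) else 0))) / F m
     else 0)" for h c
  define H where "H = wfrec R step"
  have H: "H c = step (cut H R c) c" for c
    using wfrec[OF \<open>wf R\<close>, of step] by (simp add: H_def)
  have H0: "H c = 0" if "c \<notin> M" for c using that H[of c] by (simp add: step_def)
  have Hrec: "F m * H c + (\<Sum>a\<in>supp F - {m}. F a * H (c - (a - m))) = (if c = 0 then 1 else 0)" for c
  proof (cases "c \<in> M")
    case True
    have "(if c - (a - m) \<in> M then cut H R c (c - (a - m)) else 0) = H (c - (a - m))"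
      if "a \<in> supp F - {m}" for a
    proof (cases "c - (a - m) \<in> M")
      case in_M: True
      have "a - m \<in> A" using that unfolding A_def by blast
      then have "c - (a - m) \<sqsubset> c"
        using O.add_strict_left_mono[OF pos, of "a - m" "c - (a - m)"] by simp
      then have "(c - (a - m), c) \<in> R" using True in_M by (simp add: R_def)
      then show ?thesis using in_M by (simp add: cut_apply)
    qed (simp add: H0)
    then have "H c = ((if c = 0 then 1 else 0) - (\<Sum>a\<in>supp F - {m}. F a * H (c - (a - m)))) / F m"
      using True by (subst H) (simp add: step_def)
    then show ?thesis using m(1) by (simp add: supp_def)
  next
    case False
    \<comment> \<open>Outside \<open>M\<close> the equation reads \<open>0 = 0\<close>: since
      \<open>M\<close> is closed under adding \<open>a - m\<close>, no shifted argument lies in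
      \<open>M\<close>, and \<open>c\<close> is not 0 because \<open>0 \<in> M\<close>.\<close>
    have "H (c - (a - m)) = 0" if "a \<in> supp F - {m}" for a
    proof (rule H0, rule notI)
      assume "c - (a - m) \<in> M"
      moreover have "a - m \<in> A" using that unfolding A_def by blast
      ultimately have "(a - m) + (c - (a - m)) \<in> M" by (intro M(3))
      then show False using False by simp
    qed
    then show ?thesis using False M(2) by (auto simp: H0)
  qed
  \<comment> \<open>\<open>H\<close> inverts \<open>F\<close> divided by the monomial
    \<open>m\<close>; the shift accounts for that monomial.\<close>
  define G where "G c = H (c + m)" for c
  have "supp H \<subseteq> M" unfolding supp_def using H0 by blast
  then have "H \<in> MN \<rho>" using O.wo_subset[OF M(1)] by (simp add: MN_iff)
  moreover have "G = mono (- m) \<star> H" by (rule ext) (simp add: G_def mono_mult)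
  ultimately have "G \<in> MN \<rho>" by simp
  moreover have "F \<star> G = mono 0"
  proof
    fix c
    have "(F \<star> G) c = (\<Sum>a\<in>supp F. F a * G (c - a))"
      by (rule mn_mult_eq[OF fin]) blast
    also have "\<dots> = F m * H c + (\<Sum>a\<in>supp F - {m}. F a * H (c - (a - m)))"
      by (simp add: sum.remove[OF fin m(1)] G_def algebra_simps)
    also have "\<dots> = mono 0 c" by (simp add: Hrec mono_def)
    finally show "(F \<star> G) c = mono 0 c" .
  qed
  ultimately show ?thesis by (rule that)
qed

section \<open>Splitting by powers of \<lambda>; \<open>part {0}\<close> is the constant
  term\<close>

definition part :: "int set \<Rightarrow> 'n series \<Rightarrow> 'n series" where
  "part I F c = (if fst c \<in> I then F c else 0)"

lemma supp_part: "supp (part I F) = {a \<in> supp F. fst a \<in> I}"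
  by (auto simp: supp_def part_def)

lemma part_MN [simp]: "F \<in> MN \<rho> \<Longrightarrow> part I F \<in> MN \<rho>"
  by (rule MN_subset) (auto simp: supp_part)

lemma part_id: "fst ` supp F \<subseteq> I \<Longrightarrow> part I F = F"
  by (rule ext) (force simp: part_def supp_def)

lemma part_disjoint: "fst ` supp F \<inter> I = {} \<Longrightarrow> part I F = 0"
  by (rule ext) (force simp: part_def supp_def)

lemma part_add: "part I (F + G) = part I F + part I G"
  by (rule ext) (simp add: part_def)

lemma part_split: "part I F + part (- I) F = F"
  by (rule ext) (simp add: part_def)

lemma degrees_mult:
  fixes F G :: "'n series"
  assumes "fst ` supp F \<subseteq> I" "fst ` supp G \<subseteq> J"
  shows "fst ` supp (F \<star> G) \<subseteq> {i + j | i j. i \<in> I \<and> j \<in> J}"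
proof
  fix k assume "k \<in> fst ` supp (F \<star> G)"
  then obtain a b where "a \<in> supp F" "b \<in> supp G" "k = fst a + fst b"
    using supp_mult[of F G] unfolding O.sumset_def by fastforce
  then show "k \<in> {i + j | i j. i \<in> I \<and> j \<in> J}" using assms by blast
qed

text \<open>Multiplication by a series free of \<lambda> preserves exponents of \<lambda>, so it
  maps the parts of \<open>G\<close> over \<open>I\<close> and over \<open>- I\<close> to the same
  parts of the product.\<close>

lemma part_mult:
  assumes "F \<in> MN \<rho>" "G \<in> MN \<rho>" "fst ` supp F \<subseteq> {0}"
  shows "part I (F \<star> G) = F \<star> part I G"
proof -
  have deg: "fst ` supp (F \<star> part J G) \<subseteq> J" for J
    using degrees_mult[OF assms(3), of "part J G" J] by (auto simp: supp_part)
  have "F \<star> G = F \<star> part I G + F \<star> part (- I) G"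
    using mult_add[of F "part I G" "part (- I) G"] assms by (simp add: part_split)
  moreover have "part I (F \<star> part (- I) G) = 0"
    using deg[of "- I"] by (intro part_disjoint) blast
  moreover have "part I (F \<star> part I G) = F \<star> part I G"
    by (rule part_id[OF deg])
  ultimately show ?thesis by (simp add: part_add)
qed

section \<open>Expansions of rational functions\<close>

definition emb :: "('n \<Rightarrow>\<^sub>0 nat) \<Rightarrow> 'n monomial" where
  "emb e = (0, Poly_Mapping.map int e)"

lemma lookup_map_int:
  fixes e :: "'n \<Rightarrow>\<^sub>0 nat"
  shows "Poly_Mapping.lookup (Poly_Mapping.map int e) k = int (Poly_Mapping.lookup e k)"
  by transfer (simp add: when_def)

lemma emb_add: "emb (d + e) = emb d + emb e"
  by (simp add: emb_def) (rule poly_mapping_eqI, simp add: lookup_add lookup_map_int)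

lemma emb_0: "emb 0 = 0"
  unfolding emb_def zero_prod_def by (simp add: poly_mapping_eqI lookup_map_int)

lemma emb_inject [simp]: "emb d = emb e \<longleftrightarrow> d = e"
proof
  assume "emb d = emb e"
  then have "Poly_Mapping.lookup (Poly_Mapping.map int d) k = Poly_Mapping.lookup (Poly_Mapping.map int e) k" for k
    by (simp add: emb_def)
  then show "d = e" by (intro poly_mapping_eqI) (simp add: lookup_map_int)
qed simp

abbreviation MS :: "(('n \<Rightarrow>\<^sub>0 nat) \<Rightarrow>\<^sub>0 complex) \<Rightarrow> 'n series" where
  "MS \<equiv> mpoly_series"

lemma mpoly_series_eq:
  assumes "finite X" "Poly_Mapping.keys P \<subseteq> X"
  shows "MS P c = (\<Sum>e\<in>X. if c = emb e then Poly_Mapping.lookup P e else 0)"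
  unfolding mpoly_series_def emb_def[symmetric]
  using assms by (intro sum.mono_neutral_left) (auto simp: in_keys_iff)

lemma mpoly_series_emb: "MS P (emb e) = Poly_Mapping.lookup P e"
  by (subst mpoly_series_eq[of "insert e (Poly_Mapping.keys P)"]) auto

lemma supp_mpoly_series: "supp (MS P) \<subseteq> emb ` Poly_Mapping.keys P"
proof -
  have "MS P c = 0" if "c \<notin> emb ` Poly_Mapping.keys P" for c
    using that by (subst mpoly_series_eq[of "Poly_Mapping.keys P"]) (auto intro!: sum.neutral)
  then show ?thesis unfolding supp_def by blast
qed

lemma finite_supp_mpoly [simp]: "finite (supp (MS P))"
  by (rule finite_subset[OF supp_mpoly_series]) simp

lemma mpoly_MN [simp]: "MS P \<in> MN \<rho>"
  by (simp add: finite_supp_MN)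

lemma degrees_mpoly: "fst ` supp (MS P) \<subseteq> {0}"
  using supp_mpoly_series[of P] by (force simp: emb_def)

lemma mpoly_0 [simp]: "MS 0 = 0"
  by (rule ext) (simp add: mpoly_series_def)

lemma mpoly_1 [simp]: "MS 1 = mono 0"
  by (rule ext) (simp add: mpoly_series_eq[of "{0}"] mono_def emb_0 lookup_one)

lemma mpoly_add: "MS (P + Q) = MS P + MS Q"
proof
  fix c
  have "finite (Poly_Mapping.keys P \<union> Poly_Mapping.keys Q)" by simp
  note eq = mpoly_series_eq[OF this]
  show "MS (P + Q) c = (MS P + MS Q) c"
    by (simp add: eq keys_add sum.distrib[symmetric] lookup_add if_distrib cong: if_cong)
qed

text \<open>Writing both polynomials as sums of single terms reduces the product to adding
  exponents, which \<open>emb\<close> respects.\<close>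

lemma mpoly_mult: "MS (P * Q) = MS P \<star> MS Q"
proof
  fix c
  have decomp: "R = (\<Sum>k\<in>Poly_Mapping.keys R. Poly_Mapping.single k (Poly_Mapping.lookup R k))" for R :: "('n \<Rightarrow>\<^sub>0 nat) \<Rightarrow>\<^sub>0 complex"
    by (rule poly_mapping_eqI) (simp add: lookup_sum lookup_single when_def in_keys_iff)
  have sum: "MS (sum f A) c = (\<Sum>x\<in>A. MS (f x) c)"
    if "finite A" for f :: "_ \<Rightarrow> ('n \<Rightarrow>\<^sub>0 nat) \<Rightarrow>\<^sub>0 complex" and A :: "('n \<Rightarrow>\<^sub>0 nat) set"
    using that by induction (simp_all add: mpoly_add)
  have single: "MS (Poly_Mapping.single k x) c = (if c = emb k then x else 0)" for k x
    by (subst mpoly_series_eq[of "{k}"]) auto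
  have "P * Q = (\<Sum>k\<in>Poly_Mapping.keys P. \<Sum>l\<in>Poly_Mapping.keys Q. Poly_Mapping.single (k + l) (Poly_Mapping.lookup P k * Poly_Mapping.lookup Q l))"
    by (subst decomp[of P], subst decomp[of Q]) (simp add: sum_product mult_single)
  then have "MS (P * Q) c
      = (\<Sum>k\<in>Poly_Mapping.keys P. \<Sum>l\<in>Poly_Mapping.keys Q. if c = emb (k + l) then Poly_Mapping.lookup P k * Poly_Mapping.lookup Q l else 0)"
    by (simp add: sum single)
  also have "\<dots> = (\<Sum>k\<in>Poly_Mapping.keys P. Poly_Mapping.lookup P k * MS Q (c - emb k))"
    by (intro sum.cong refl)
      (auto simp: mpoly_series_eq[of "Poly_Mapping.keys Q" Q] sum_distrib_left emb_add algebra_simps intro!: sum.cong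
        simp del: split_paired_All)
  also have "\<dots> = (\<Sum>a\<in>emb ` Poly_Mapping.keys P. MS P a * MS Q (c - a))"
    by (subst sum.reindex) (auto simp: inj_on_def mpoly_series_emb)
  also have "\<dots> = (MS P \<star> MS Q) c"
    using supp_mpoly_series[of P] by (intro mn_mult_eq[symmetric]) auto
  finally show "MS (P * Q) c = (MS P \<star> MS Q) c" .
qed

lemma mpoly_nonzero: "P \<noteq> 0 \<Longrightarrow> MS P \<noteq> 0"
proof
  assume "P \<noteq> 0" "MS P = 0"
  then have "Poly_Mapping.lookup P e = 0" for e using mpoly_series_emb[of P e] by simp
  with \<open>P \<noteq> 0\<close> show False by (simp add: poly_mapping_eqI)
qed

section \<open>Expansions of rational functions in the variables x\<close>

abbreviation K :: "'n ratfun \<Rightarrow> 'n series" where "K \<equiv> K_series \<rho>"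

text \<open>Solutions \<open>S\<close> and \<open>T\<close> belonging to two representations of the
  same fraction agree after multiplication by \<open>b * b'\<close>, which can be cancelled.\<close>

lemma K_eqI:
  assumes b: "b \<noteq> 0" and S: "S \<in> MN \<rho>" "MS b \<star> S = MS a"
  shows "K (Fract a b) = S"
  unfolding K_series_def
proof (rule the_equality)
  show "S \<in> MN \<rho> \<and> (\<exists>a' b'. b' \<noteq> 0 \<and> Fract a b = Fract a' b' \<and> MS b' \<star> S = MS a')"
    using assms by blast
  fix T assume "T \<in> MN \<rho> \<and> (\<exists>a' b'. b' \<noteq> 0 \<and> Fract a b = Fract a' b' \<and> MS b' \<star> T = MS a')"
  then obtain a' b' where T: "T \<in> MN \<rho>" "b' \<noteq> 0" "Fract a b = Fract a' b'"
      "MS b' \<star> T = MS a'" by blast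
  have ab: "a * b' = a' * b" using T(2,3) b by (simp add: eq_fract)
  have "MS (b * b') \<star> T = MS b \<star> (MS b' \<star> T)"
    using T(1) by (simp add: mpoly_mult mn_mult_assoc)
  also have "\<dots> = MS (b' * a)" by (simp add: T(4) mpoly_mult[symmetric] ab mult.commute)
  also have "\<dots> = MS b' \<star> (MS b \<star> S)" by (simp add: mpoly_mult S(2))
  also have "\<dots> = MS (b * b') \<star> S"
    using S(1) by (simp add: mpoly_mult mn_ac)
  finally have "MS (b * b') \<star> T = MS (b * b') \<star> S" .
  then show "T = S"
    by (rule mult_left_cancel[OF mpoly_MN mpoly_nonzero T(1) S(1), rotated]) (use b T(2) in simp)
qed

text \<open>The denominator has finite support and hence an inverse, so the quotient exists. The
  rule yields a representation together with the equation that characterises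
  \<open>K r\<close>.\<close>

lemma K_cases:
  obtains a b where "b \<noteq> 0" "r = Fract a b" "K r \<in> MN \<rho>" "MS b \<star> K r = MS a"
proof (cases r)
  case (Fract a b)
  then obtain G where G: "G \<in> MN \<rho>" "MS b \<star> G = mono 0"
    using ex_inverse_finite[OF finite_supp_mpoly mpoly_nonzero, of b] by blast
  then have S: "G \<star> MS a \<in> MN \<rho>" "MS b \<star> (G \<star> MS a) = MS a"
    by (simp_all add: mn_mult_assoc[symmetric])
  have "K r = G \<star> MS a" unfolding Fract(1) by (rule K_eqI[OF Fract(2) S])
  with S show thesis by (intro that[OF Fract(2,1)]) simp_all
qed

lemma K_MN [simp]: "K r \<in> MN \<rho>"
  by (cases r rule: K_cases)

lemma K_add: "K (r + s) = K r + K s"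
proof -
  obtain a b where r: "b \<noteq> 0" "r = Fract a b" "MS b \<star> K r = MS a" by (rule K_cases)
  obtain c d where s: "d \<noteq> 0" "s = Fract c d" "MS d \<star> K s = MS c" by (rule K_cases)
  have "MS (b * d) \<star> (K r + K s) = MS d \<star> (MS b \<star> K r) + MS b \<star> (MS d \<star> K s)"
    by (simp add: mpoly_mult mult_add mn_ac)
  also have "\<dots> = MS (a * d + c * b)"
    unfolding r(3) s(3) by (simp add: mpoly_mult mpoly_add mn_mult_commute)
  finally have "K (Fract (a * d + c * b) (b * d)) = K r + K s"
    using r(1) s(1) by (intro K_eqI) simp_all
  moreover have "r + s = Fract (a * d + c * b) (b * d)"
    unfolding r(2) s(2) using r(1) s(1) by (rule add_fract)
  ultimately show ?thesis by simp
qed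

lemma K_mult: "K (r * s) = K r \<star> K s"
proof -
  obtain a b where r: "b \<noteq> 0" "r = Fract a b" "MS b \<star> K r = MS a" by (rule K_cases)
  obtain c d where s: "d \<noteq> 0" "s = Fract c d" "MS d \<star> K s = MS c" by (rule K_cases)
  have "MS (b * d) \<star> (K r \<star> K s) = (MS b \<star> K r) \<star> (MS d \<star> K s)"
    by (simp add: mpoly_mult mn_ac)
  also have "\<dots> = MS (a * c)"
    unfolding r(3) s(3) by (simp add: mpoly_mult)
  finally have "K (Fract (a * c) (b * d)) = K r \<star> K s"
    using r(1) s(1) by (intro K_eqI) simp_all
  moreover have "r * s = Fract (a * c) (b * d)"
    unfolding r(2) s(2) by (rule mult_fract)
  ultimately show ?thesis by simp
qed

lemma K_0 [simp]: "K 0 = 0"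
  using K_eqI[of 1 0 0] by (simp add: Zero_fract_def)

lemma K_1 [simp]: "K 1 = mono 0"
  using K_eqI[of 1 "mono 0" 1] by (simp add: One_fract_def)

lemma mono_nonzero [simp]: "mono a \<noteq> 0"
  by (metis supp_mono supp_0 insert_not_empty)

lemma K_nonzero:
  assumes "r \<noteq> 0" shows "K r \<noteq> 0"
proof
  assume "K r = 0"
  then have "K (r * inverse r) = 0" by (simp add: K_mult)
  then show False using assms by simp
qed

text \<open>Numerator and denominator are free of \<lambda>, so the constant term of
  \<open>K r\<close> solves the same equation and equals \<open>K r\<close> by uniqueness.\<close>

lemma degrees_K: "fst ` supp (K r) \<subseteq> {0}"
proof -
  obtain a b where *: "b \<noteq> 0" "r = Fract a b" "MS b \<star> K r = MS a" by (rule K_cases)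
  have "MS b \<star> part {0} (K r) = part {0} (MS b \<star> K r)"
    using degrees_mpoly by (simp add: part_mult)
  also have "\<dots> = MS a" unfolding *(3) by (rule part_id[OF degrees_mpoly])
  finally have "K (Fract a b) = part {0} (K r)" using *(1) by (intro K_eqI) simp_all
  then have "K r = part {0} (K r)" unfolding *(2) .
  then have "supp (K r) = supp (part {0} (K r))" by simp
  then show ?thesis by (auto simp: supp_part)
qed

lemma K_off: "i \<noteq> 0 \<Longrightarrow> K r (i, m) = 0"
  using degrees_K[of r] by (force simp: supp_def)

section \<open>Expansions of polynomials in \<lambda> and of their quotients\<close>

abbreviation PS :: "'n ratfun poly \<Rightarrow> 'n series" where "PS \<equiv> poly_series \<rho>"

text \<open>Coefficients are free of \<lambda>, so only the summand with \<open>j = i\<close>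
  contributes; the degree bound disappears because higher coefficients vanish.\<close>

lemma PS_apply: "PS p (i, m) = (if i < 0 then 0 else K (coeff p (nat i)) (0, m))"
proof -
  have "PS p (i, m) = (\<Sum>j\<le>degree p. if j = nat i \<and> 0 \<le> i then K (coeff p j) (0, m) else 0)"
    unfolding poly_series_def by (auto intro!: sum.cong simp: K_off)
  also have "\<dots> = (if i < 0 then 0 else K (coeff p (nat i)) (0, m))"
    by (cases "i < 0") (auto simp: coeff_eq_0)
  finally show ?thesis .
qed

lemma PS_0 [simp]: "PS 0 = 0"
  by (auto simp: PS_apply)

lemma PS_add: "PS (p + q) = PS p + PS q"
  by (auto simp: PS_apply K_add)

text \<open>The Horner form, which opens properties of \<open>PS\<close> to induction on the
  polynomial.\<close>

lemma PS_pCons: "PS (pCons a p) = K a + mono (1, 0) \<star> PS p"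
proof (rule ext, clarify)
  fix i m
  show "PS (pCons a p) (i, m) = (K a + mono (1, 0) \<star> PS p) (i, m)"
  proof (cases "i > 0")
    case True
    then have "nat i = Suc (nat (i - 1))" by simp
    with True show ?thesis by (simp add: mono_mult PS_apply K_off)
  next
    case False
    then show ?thesis by (cases "i = 0") (auto simp: mono_mult PS_apply K_off)
  qed
qed

text \<open>
  In the following inductions \<open>simp\<close> must not evaluate sums of series pointwise: it would do so
  under the eta-expansions left by \<open>induction\<close>.
\<close>

lemmas pointwise = plus_fun_apply zero_fun_apply

lemma PS_MN [simp]: "PS p \<in> MN \<rho>"
  by (induction p) (simp_all add: PS_pCons del: pointwise)

lemma PS_smult: "PS (smult a p) = K a \<star> PS p"
proof (induction p)
  case (pCons b p)
  then show ?case by (simp add: PS_pCons K_mult mult_add mn_mult_left_commute del: pointwise)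
qed (simp del: pointwise)

lemma PS_mult: "PS (p * q) = PS p \<star> PS q"
proof (induction p)
  case (pCons a p)
  then show ?case
    by (simp add: PS_add PS_smult PS_pCons add_mult mn_mult_assoc del: pointwise)
qed (simp del: pointwise)

lemma degrees_PS: "fst ` supp (PS p) \<subseteq> {0..int (degree p)}"
  by (force simp: supp_def PS_apply coeff_eq_0 split: if_splits intro: ccontr)

lemma PS_nonzero:
  assumes "p \<noteq> 0" shows "PS p \<noteq> 0"
proof
  assume "PS p = 0"
  then have "K (lead_coeff p) (0, m) = 0" for m
    using PS_apply[of p "int (degree p)" m] by simp
  then have "K (lead_coeff p) = 0" by (auto simp: fun_eq_iff) (metis K_off)
  then show False using K_nonzero[of "lead_coeff p"] assms by simp
qed

text \<open>The coefficients of \<open>p\<close> may expand to infinite series; \<open>D\<close>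
  collects their denominators. It brings \<open>PS p\<close> within reach of
  \<open>ex_inverse_finite\<close>.\<close>

lemma clear_denominators:
  "\<exists>D. finite (supp D) \<and> D \<noteq> 0 \<and> finite (supp (D \<star> PS p))"
proof (induction p)
  case 0
  show ?case by (intro exI[of _ "mono 0"]) (simp del: pointwise)
next
  case (pCons a p)
  then obtain D where D: "finite (supp D)" "D \<noteq> 0" "finite (supp (D \<star> PS p))" by blast
  then have [simp]: "D \<in> MN \<rho>" by (simp add: finite_supp_MN)
  show ?case
  proof (cases a rule: K_cases)
    case (1 c b)
    \<comment> \<open>In the first summand \<open>MS b\<close> turns \<open>K a\<close> into the
      polynomial \<open>MS c\<close>; in the second, \<open>D\<close> already clears
      \<open>PS p\<close>.\<close>
    have eq: "MS b \<star> D \<star> PS (pCons a p)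
      = D \<star> (MS b \<star> K a) + MS b \<star> (mono (1, 0) \<star> (D \<star> PS p))"
      by (simp add: PS_pCons mult_add mn_ac)
    have "finite (supp (MS b \<star> D \<star> PS (pCons a p)))"
      unfolding eq 1(4)
      by (intro finite_subset[OF supp_add] finite_UnI finite_supp_mult[OF D(1)]
          finite_supp_mult[OF finite_supp_mpoly finite_supp_mult[OF _ D(3)]]) simp_all
    then show ?thesis
      using D mult_nonzero[of "MS b" D] mpoly_nonzero[OF 1(1)]
      by (intro exI[of _ "MS b \<star> D"]) (simp add: finite_supp_mult del: pointwise)
  qed
qed

text \<open>If \<open>G\<close> inverts the cleared denominator \<open>D \<star> PS q\<close>, then
  \<open>D \<star> G\<close> inverts \<open>PS q\<close>.\<close>

lemma ex_quotient:
  assumes "q \<noteq> 0"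
  obtains S where "S \<in> MN \<rho>" "PS q \<star> S = PS p"
proof -
  obtain D where D: "finite (supp D)" "D \<noteq> 0" "finite (supp (D \<star> PS q))"
    using clear_denominators by blast
  then have [simp]: "D \<in> MN \<rho>" by (simp add: finite_supp_MN)
  obtain G where G: "G \<in> MN \<rho>" "D \<star> PS q \<star> G = mono 0"
    using ex_inverse_finite[OF D(3)] mult_nonzero[of D "PS q"] D(2) PS_nonzero[OF assms] by auto
  have "PS q \<star> (D \<star> G \<star> PS p) = D \<star> PS q \<star> G \<star> PS p" using G(1) by (simp add: mn_ac)
  also have "\<dots> = PS p" by (simp add: G(2))
  finally show ?thesis using that[of "D \<star> G \<star> PS p"] G(1) by simp
qed

text \<open>Uniqueness by cross-multiplication and cancellation, as for
  \<open>K_eqI\<close>.\<close>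

lemma expansion_eqI:
  assumes q: "q \<noteq> 0" and S: "S \<in> MN \<rho>" "PS q \<star> S = PS p"
  shows "expansion \<rho> (Fract p q) = S"
  unfolding expansion_def
proof (rule the_equality)
  show "S \<in> MN \<rho> \<and> (\<exists>p' q'. q' \<noteq> 0 \<and> Fract p q = Fract p' q' \<and> PS q' \<star> S = PS p')"
    using assms by blast
  fix T assume "T \<in> MN \<rho> \<and> (\<exists>p' q'. q' \<noteq> 0 \<and> Fract p q = Fract p' q' \<and> PS q' \<star> T = PS p')"
  then obtain p' q' where T: "T \<in> MN \<rho>" "q' \<noteq> 0" "Fract p q = Fract p' q'" "PS q' \<star> T = PS p'" by blast
  have pq: "p * q' = p' * q" using T(2,3) q by (simp add: eq_fract)
  have "PS (q * q') \<star> T = PS q \<star> (PS q' \<star> T)"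
    using T(1) by (simp add: PS_mult mn_mult_assoc)
  also have "\<dots> = PS (q' * p)" by (simp add: T(4) PS_mult[symmetric] pq mult.commute)
  also have "\<dots> = PS q' \<star> (PS q \<star> S)" by (simp add: PS_mult S(2))
  also have "\<dots> = PS (q * q') \<star> S"
    using S(1) by (simp add: PS_mult mn_ac)
  finally have "PS (q * q') \<star> T = PS (q * q') \<star> S" .
  then show "T = S"
    by (rule mult_left_cancel[OF PS_MN PS_nonzero T(1) S(1), rotated]) (use q T(2) in simp)
qed

section \<open>Initial terms and constant terms\<close>

text \<open>The least monomial of \<open>PS q\<close> lies in the support of one term
  \<open>t i\<close> and is least there. The term of index \<open>j\<close> has order at most that
  of \<open>t i\<close>, so the least monomial comes from \<open>t j\<close>. The later arguments
  use initial terms only through this exponent of \<lambda>.\<close>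

lemma initial_index_lm:
  assumes "initial_index \<rho> q j"
  shows "fst (lm (PS q)) = int j" and "q \<noteq> 0"
proof -
  show "q \<noteq> 0" using assms by (auto simp: initial_index_def)
  then have q: "PS q \<noteq> 0" by (rule PS_nonzero)
  define t where "t i = PS (monom (coeff q i) i)" for i
  have t_apply: "t i (k, m) = (if k = int i then PS q (k, m) else 0)" for i k m
    by (auto simp: t_def PS_apply)
  have t_MN: "t i \<in> MN \<rho>" for i by (simp add: t_def)
  have t_nz: "t i \<noteq> 0" if "coeff q i \<noteq> 0" for i
    unfolding t_def using that by (intro PS_nonzero) simp
  have t_sub: "supp (t i) \<subseteq> supp (PS q)" for i
    by (auto simp: supp_def t_apply split: if_splits)
  have fst_t: "fst (lm (t i)) = int i" if "coeff q i \<noteq> 0" for i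
    using lm_in[OF t_MN t_nz[OF that]] by (cases "lm (t i)") (auto simp: supp_def t_apply split: if_splits)
  obtain k m where km: "lm (PS q) = (k, m)" by (cases "lm (PS q)")
  then have km_in: "(k, m) \<in> supp (PS q)" using lm_in[OF PS_MN q] by simp
  then have k: "k \<ge> 0" by (auto simp: supp_def PS_apply split: if_splits)
  define i where "i = nat k"
  have i: "k = int i" using k by (simp add: i_def)
  have ci: "coeff q i \<noteq> 0" using km_in by (auto simp: supp_def PS_apply i)
  have "lm (t i) = lm (PS q)"
    using lm_le[OF PS_MN q] t_sub[of i] km km_in by (intro lm_eqI) (auto simp: supp_def t_apply i)
  moreover have cj: "coeff q j \<noteq> 0" using assms by (simp add: initial_index_def)
  then have "lm (PS q) \<sqsubseteq> lm (t j)"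
    using lm_le[OF PS_MN q] lm_in[OF t_MN t_nz] t_sub by blast
  moreover have "lm (t j) \<sqsubseteq> lm (t i)"
    using assms ci unfolding initial_index_def term_order_def lm_def t_def le_def by blast
  ultimately have "lm (PS q) = lm (t j)" using O.order_antisym by metis
  then show "fst (lm (PS q)) = int j" using fst_t[OF cj] by simp
qed

text \<open>Least monomials add under multiplication, and their exponents of \<lambda> lie between 0
  and the degree. The sum 0 for \<open>g * h1\<close> forces exponent 0 for \<open>g\<close>; the
  maximal sum for \<open>g * h2\<close> forces exponent \<open>degree g\<close>.\<close>

lemma common_divisor_degree:
  assumes "recip_PT \<rho> q1" "recip_NT \<rho> q2" "g dvd q1" "g dvd q2"
  shows "degree g = 0"
proof -
  obtain h1 h2 where h: "q1 = g * h1" "q2 = g * h2" using assms(3,4) by (auto elim!: dvdE)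
  note 1 = initial_index_lm[OF assms(1)[unfolded recip_PT_def]]
  note 2 = initial_index_lm[OF assms(2)[unfolded recip_NT_def]]
  have nz: "g \<noteq> 0" "h1 \<noteq> 0" "h2 \<noteq> 0" using h 1(2) 2(2) by auto
  have lm: "fst (lm (PS p)) \<in> {0..int (degree p)}" if "p \<noteq> 0" for p
    using lm_in[OF PS_MN PS_nonzero[OF that]] degrees_PS[of p] by blast
  have "fst (lm (PS g)) + fst (lm (PS h1)) = 0"
    using 1(1) nz by (simp add: h PS_mult lm_mult PS_nonzero)
  moreover have "fst (lm (PS g)) + fst (lm (PS h2)) = int (degree g + degree h2)"
    using 2(1) nz by (simp add: h PS_mult lm_mult PS_nonzero degree_mult_eq)
  ultimately show ?thesis using lm[OF nz(1)] lm[OF nz(2)] lm[OF nz(3)] by auto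
qed

text \<open>Once \<open>S\<close> is known to have only nonnegative powers of \<lambda>, comparing
  constant terms in \<open>PS q \<star> S = PS p\<close> leaves a linear equation over the
  coefficient field.\<close>

lemma quotient_PT:
  assumes q: "recip_PT \<rho> q" and S: "S \<in> MN \<rho>" "PS q \<star> S = PS p"
  shows "part {0} S = K (coeff p 0 / coeff q 0)"
proof -
  note lmq = initial_index_lm[OF q[unfolded recip_PT_def]]
  let ?N = "part {..<0} S" and ?P = "part (- {..<0}) S"
  have "?N = 0"
  proof (rule ccontr)
    assume nz: "?N \<noteq> 0"
    have "PS q \<star> ?N + PS q \<star> ?P = PS p"
      using S(1) by (simp only: mult_add[symmetric] part_MN PS_MN part_split S(2))
    then have eq: "PS q \<star> ?N = PS p - PS q \<star> ?P" by (simp add: algebra_simps)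
    have "fst ` supp ?P \<subseteq> {0..}" by (auto simp: supp_part)
    from degrees_mult[OF degrees_PS this, of q] have "fst ` supp (PS q \<star> ?P) \<subseteq> {0..}" by fastforce
    moreover have "supp (PS q \<star> ?N) \<subseteq> supp (PS p) \<union> supp (PS q \<star> ?P)"
      unfolding eq by (force simp: supp_def)
    ultimately have "fst ` supp (PS q \<star> ?N) \<subseteq> {0..}" using degrees_PS[of p] by fastforce
    moreover have "lm (PS q \<star> ?N) \<in> supp (PS q \<star> ?N)"
      using nz S(1) lmq(2) by (intro lm_in mult_nonzero) (auto simp: PS_nonzero)
    ultimately have "fst (lm (PS q \<star> ?N)) \<ge> 0" by auto
    moreover have "lm (PS q \<star> ?N) = lm (PS q) + lm ?N"
      using nz S(1) lmq(2) by (intro lm_mult) (auto simp: PS_nonzero)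
    moreover have "fst (lm ?N) < 0"
      using lm_in[OF _ nz] S(1) by (auto simp: supp_part)
    ultimately show False using lmq(1) by simp
  qed
  then have "S = ?P" using part_split[of "{..<0}" S] by simp
  moreover have "fst ` supp ?P \<subseteq> {0..}" by (auto simp: supp_part)
  ultimately have deg: "fst ` supp S \<subseteq> {0..}" by metis
  obtain a q' where qa: "q = pCons a q'" by (cases q)
  obtain c p' where pc: "p = pCons c p'" by (cases p)
  have "a \<noteq> 0" using q qa by (simp add: recip_PT_def initial_index_def)
  \<comment> \<open>Multiplying nonnegative powers by \<lambda> leaves no constant term, so only the
    constant coefficients \<open>a\<close> and \<open>c\<close> survive.\<close>
  have drop: "part {0} (mono (1, 0) \<star> F) = 0" if "fst ` supp F \<subseteq> {0..}" for F :: "'n series"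
    using degrees_mult[of "mono (1, 0)" "{1}" F, OF _ that] by (intro part_disjoint) force
  have "fst ` supp (PS q' \<star> S) \<subseteq> {0..}"
    using degrees_mult[OF degrees_PS deg, of q'] by force
  then have "part {0} (PS q \<star> S) = part {0} (K a \<star> S)"
    using S(1) drop by (simp add: qa PS_pCons add_mult mn_mult_assoc part_add)
  moreover have "fst ` supp (PS p') \<subseteq> {0..}" using degrees_PS[of p'] by fastforce
  then have "part {0} (PS p) = K c"
    by (simp add: pc PS_pCons part_add drop part_id[OF degrees_K])
  ultimately have "K a \<star> part {0} S = K c"
    using S degrees_K by (simp add: part_mult)
  also have "\<dots> = K a \<star> K (c / a)" using \<open>a \<noteq> 0\<close> by (simp add: K_mult[symmetric])
  finally show ?thesis
    using mult_left_cancel[of "K a"] K_nonzero[OF \<open>a \<noteq> 0\<close>] S(1) by (simp add: qa pc)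
qed

text \<open>The degree bound keeps \<open>PS p - PS q \<star> ?N\<close> in exponents below
  \<open>degree q\<close>, whereas the least monomial of \<open>PS q \<star> ?P\<close> would have
  exponent at least \<open>degree q\<close>. The alternative \<open>p = 0\<close> covers constant
  \<open>q\<close>.\<close>

lemma quotient_NT:
  assumes q: "recip_NT \<rho> q" and p: "p = 0 \<or> degree p < degree q"
    and S: "S \<in> MN \<rho>" "PS q \<star> S = PS p"
  shows "part {0} S = 0"
proof -
  note lmq = initial_index_lm[OF q[unfolded recip_NT_def]]
  let ?P = "part {0..} S" and ?N = "part (- {0..}) S"
  let ?d = "int (degree q)"
  have "?P = 0"
  proof (rule ccontr)
    assume nz: "?P \<noteq> 0"
    have "PS q \<star> ?P + PS q \<star> ?N = PS p"
      using S(1) by (simp only: mult_add[symmetric] part_MN PS_MN part_split S(2))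
    then have eq: "PS q \<star> ?P = PS p - PS q \<star> ?N" by (simp add: algebra_simps)
    have "fst ` supp ?N \<subseteq> {..<0}" by (auto simp: supp_part)
    from degrees_mult[OF degrees_PS this, of q] have "fst ` supp (PS q \<star> ?N) \<subseteq> {..<?d}" by fastforce
    moreover have "supp (PS q \<star> ?P) \<subseteq> supp (PS p) \<union> supp (PS q \<star> ?N)"
      unfolding eq by (force simp: supp_def)
    moreover have "fst ` supp (PS p) \<subseteq> {..<?d}" using p degrees_PS[of p] by fastforce
    ultimately have "fst ` supp (PS q \<star> ?P) \<subseteq> {..<?d}" by fastforce
    moreover have "lm (PS q \<star> ?P) \<in> supp (PS q \<star> ?P)"
      using nz S(1) lmq(2) by (intro lm_in mult_nonzero) (auto simp: PS_nonzero)
    ultimately have "fst (lm (PS q \<star> ?P)) < ?d" by auto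
    moreover have "lm (PS q \<star> ?P) = lm (PS q) + lm ?P"
      using nz S(1) lmq(2) by (intro lm_mult) (auto simp: PS_nonzero)
    moreover have "fst (lm ?P) \<ge> 0"
      using lm_in[OF _ nz] S(1) by (auto simp: supp_part)
    ultimately show False using lmq(1) by simp
  qed
  then have "S = ?N" using part_split[of "{0..}" S] by simp
  moreover have "part {0} ?N = 0" by (rule part_disjoint) (auto simp: supp_part)
  ultimately show ?thesis by metis
qed

end

section \<open>Partial fractions and the rationality of the constant term\<close>

lemma ex_bezout:
  fixes p q :: "'a::field poly"
  assumes "\<And>g. g dvd p \<Longrightarrow> g dvd q \<Longrightarrow> degree g = 0" and "p \<noteq> 0"
  obtains u v where "u * p + v * q = 1"
proof -
  define I where "I = {u * p + v * q | u v. True}"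
  have "p \<in> I" unfolding I_def by (intro CollectI exI[of _ 1] exI[of _ 0]) simp
  \<comment> \<open>A nonzero element of least degree in the ideal \<open>I\<close> divides every
    element of \<open>I\<close>: remainders stay in \<open>I\<close> and have smaller degree. As a
    common divisor of \<open>p\<close> and \<open>q\<close> it is a constant, which is scaled to
    1.\<close>
  then obtain g where g: "g \<in> I" "g \<noteq> 0" "\<And>h. h \<in> I \<Longrightarrow> h \<noteq> 0 \<Longrightarrow> degree g \<le> degree h"
    using ex_has_least_nat[of "\<lambda>h. h \<in> I \<and> h \<noteq> 0" p degree] assms(2) by blast
  then obtain s t where st: "g = s * p + t * q" by (auto simp: I_def)
  have dvd: "g dvd h" if "h \<in> I" for h
  proof -
    from that obtain u v where h: "h = u * p + v * q" by (auto simp: I_def)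
    let ?k = "h div g"
    have "h mod g = h - ?k * g" by (simp add: minus_div_mult_eq_mod)
    also have "\<dots> = (u - ?k * s) * p + (v - ?k * t) * q"
      unfolding h st by (simp add: algebra_simps)
    finally have "h mod g \<in> I" unfolding I_def by blast
    then have "h mod g = 0" using g(3) degree_mod_less[OF g(2), of h] by force
    then show ?thesis by (simp add: mod_eq_0_iff_dvd)
  qed
  have "q \<in> I" unfolding I_def by (intro CollectI exI[of _ 0] exI[of _ 1]) simp
  then have "degree g = 0" using assms(1) dvd \<open>p \<in> I\<close> by blast
  then obtain c where c: "g = [:c:]" by (auto elim: degree_eq_zeroE)
  then have "c \<noteq> 0" using g(2) by simp
  have "smult (1 / c) s * p + smult (1 / c) t * q = smult (1 / c) g"
    by (simp add: st smult_add_right)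
  also have "\<dots> = 1" using \<open>c \<noteq> 0\<close> by (simp add: c one_pCons)
  finally show ?thesis by (rule that)
qed

theorem theorem3p4:
  fixes \<rho> :: "'n::{finite,linorder} monomial rel"
    and p q :: "'n ratfun poly"
  assumes "monomial_order \<rho>"
    and "factorable \<rho> q"
  shows "\<exists>r :: 'n ratfun. CT \<rho> (Fract p q) = K_series \<rho> r"
proof -
  interpret ordered_monomials \<rho> by unfold_locales (fact assms(1))
  obtain q1 q2 where q: "q = q1 * q2" and PT: "recip_PT \<rho> q1" and NT: "recip_NT \<rho> q2"
    using assms(2) by (auto simp: factorable_def)
  have nz: "q1 \<noteq> 0" "q2 \<noteq> 0"
    using PT NT initial_index_lm(2) unfolding recip_PT_def recip_NT_def by blast+
  obtain u v where uv: "u * q1 + v * q2 = 1"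
    using ex_bezout[of q1 q2] common_divisor_degree[OF PT NT] nz(1) by blast
  \<comment> \<open>From \<open>p / q = p * v / q1 + p * u / q2\<close>, the polynomial part of the
    second fraction is moved to the first, so that the remainder \<open>B\<close> meets the degree
    condition of \<open>quotient_NT\<close>.\<close>
  define B where "B = p * u mod q2"
  define A where "A = p * v + p * u div q2 * q1"
  have "p = p * (u * q1 + v * q2)" by (simp add: uv)
  also have "\<dots> = p * v * q2 + (p * u div q2 * q2 + B) * q1"
    unfolding B_def by (simp add: algebra_simps)
  finally have p: "p = A * q2 + B * q1" by (simp add: A_def algebra_simps)
  have B: "B = 0 \<or> degree B < degree q2" unfolding B_def by (rule degree_mod_less[OF nz(2)])
  obtain S T where S: "S \<in> MN \<rho>" "PS q1 \<star> S = PS A" and T: "T \<in> MN \<rho>" "PS q2 \<star> T = PS B"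
    using ex_quotient nz by metis
  \<comment> \<open>The sum of the two expansions satisfies the equation that characterises the
    expansion of \<open>p / q\<close>.\<close>
  have "PS q \<star> (S + T) = PS q2 \<star> (PS q1 \<star> S) + PS q1 \<star> (PS q2 \<star> T)"
    using S(1) T(1) by (simp add: q PS_mult mult_add mn_ac)
  also have "\<dots> = PS p" unfolding S(2) T(2) by (simp add: p PS_add PS_mult mn_mult_commute)
  finally have "expansion \<rho> (Fract p q) = S + T"
    using S(1) T(1) nz q by (intro expansion_eqI) auto
  then have "CT \<rho> (Fract p q) = part {0} (S + T)"
    by (auto simp: CT_def part_def)
  also have "\<dots> = K (coeff A 0 / coeff q1 0)"
    by (simp add: part_add quotient_PT[OF PT S] quotient_NT[OF NT B T])
  finally show ?thesis by blast
qed

end
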